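(* Let $p$ be an odd prime, let $F$ be a field of characteristic $p$, and let $t$ be transcendental over $F$. Then the polynomial $x^p-x-t$ is neither solvable in radicals nor solvable in Chebyshev radicals relative to the field $F(t)$.
   Context: For an element $x$ of a ring and an integer $n\ge 0$, the $n$-th Chebyshev power $x^{\copyright n}$ is defined by $x^{\copyright 0}=2$, $x^{\copyright 1}=x$, $x^{\copyright n}=x\,x^{\copyright (n-1)}-x^{\copyright (n-2)}$. Let $P$ be a univariate polynomial with coefficients in a field $F_0$. $P$ is solvable in radicals relative to $F_0$ if there is a tower of fields $F_0\subseteq F_1\subseteq\cdots\subseteq F_n$ such that $P$ factors completely into linear factors over $F_n$ and, for each $0<i\le n$, $F_i=F_{i-1}(r_i)$ with $r_i^{m_i}\in F_{i-1}$ for some positive integer $m_i$. $P$ is solvable in Chebyshev radicals relative to $F_0$ if there is such a tower with $r_i^{m_i}\in F_{i-1}$ replaced by $r_i^{\copyright m_i}\in F_{i-1}$ for some positive integer $m_i$. *)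

theory Defs
  imports "HOL-Computational_Algebra.Computational_Algebra"
begin

fun chebyshev_power :: "'a::ring_1 \<Rightarrow> nat \<Rightarrow> 'a" where
  "chebyshev_power x 0 = 2"
| "chebyshev_power x (Suc 0) = x"
| "chebyshev_power x (Suc (Suc n)) = x * chebyshev_power x (Suc n) - chebyshev_power x n"

definition is_subfield :: "'a::field set \<Rightarrow> bool" where
  "is_subfield K \<longleftrightarrow>
     0 \<in> K \<and> 1 \<in> K \<and>
     (\<forall>x\<in>K. \<forall>y\<in>K. x + y \<in> K \<and> x - y \<in> K \<and> x * y \<in> K) \<and>
     (\<forall>x\<in>K. inverse x \<in> K)"

definition field_adjoin :: "'a::field set \<Rightarrow> 'a \<Rightarrow> 'a set" where
  "field_adjoin K x = is_subfield hull (insert x K)"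

lemma is_subfield_field_adjoin: "is_subfield (field_adjoin K x)"
  unfolding field_adjoin_def by (rule hull_in) (auto simp: is_subfield_def)

definition transcendental_over :: "'a::field set \<Rightarrow> 'a \<Rightarrow> bool" where
  "transcendental_over K x \<longleftrightarrow>
     (\<forall>q. set (coeffs q) \<subseteq> K \<and> poly q x = 0 \<longrightarrow> q = 0)"

definition splits_over :: "'a::field set \<Rightarrow> 'a poly \<Rightarrow> bool" where
  "splits_over K P \<longleftrightarrow>
     (\<exists>c A. c \<in> K \<and> set_mset A \<subseteq> K \<and> P = smult c (\<Prod>a\<in>#A. [:- a, 1:]))"

definition is_field_embedding :: "'a::field set \<Rightarrow> ('a \<Rightarrow> 'b::field) \<Rightarrow> bool" where
  "is_field_embedding K h \<longleftrightarrow>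
     h 1 = 1 \<and> (\<forall>x\<in>K. \<forall>y\<in>K. h (x + y) = h x + h y \<and> h (x * y) = h x * h y)"

text \<open>
  A tower of fields over \<open>F\<^sub>0\<close> is given as an embedding \<open>h\<close> of \<open>F\<^sub>0\<close> into some field \<open>'b\<close>, together
  with a chain of subfields of \<open>'b\<close> starting at the image of \<open>F\<^sub>0\<close>. HOL cannot quantify over \<open>'b\<close>
  inside a formula, so \<open>'b\<close> is a parameter of the notions of solvability: a polynomial is solvable
  over \<open>F\<^sub>0\<close> if it is so for some \<open>'b\<close>, and not solvable if it is not so for every \<open>'b\<close>.
  The polynomial is understood to have its coefficients in \<open>F\<^sub>0\<close>.
\<close>

definition solvable_by_powers ::
  "('b::field \<Rightarrow> nat \<Rightarrow> 'b) \<Rightarrow> 'a::field set \<Rightarrow> 'a poly \<Rightarrow> bool" where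
  "solvable_by_powers pow F\<^sub>0 P \<longleftrightarrow>
     (\<exists>(h :: 'a \<Rightarrow> 'b) (K :: nat \<Rightarrow> 'b set) n.
        is_field_embedding F\<^sub>0 h \<and> K 0 = h ` F\<^sub>0 \<and>
        (\<forall>i<n. \<exists>r m. m > 0 \<and> pow r m \<in> K i \<and> K (Suc i) = field_adjoin (K i) r) \<and>
        splits_over (K n) (map_poly h P))"

definition solvable_in_radicals ::
  "'b::field itself \<Rightarrow> 'a::field set \<Rightarrow> 'a poly \<Rightarrow> bool" where
  "solvable_in_radicals _ = solvable_by_powers ((^) :: 'b \<Rightarrow> nat \<Rightarrow> 'b)"

definition solvable_in_chebyshev_radicals ::
  "'b::field itself \<Rightarrow> 'a::field set \<Rightarrow> 'a poly \<Rightarrow> bool" where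
  "solvable_in_chebyshev_radicals _ = solvable_by_powers (chebyshev_power :: 'b \<Rightarrow> nat \<Rightarrow> 'b)"

end

theory Submission
  imports "HOL-Algebra.Algebraic_Closure_Type" Defs
begin

text \<open>
  The root \<open>y\<close> of \<open>x\<^sup>p - x - t\<close> is kept out of every tower by working inside the algebraic closure
  of the field in which the tower lives, where towers may be enlarged freely. The invariant
  (\<open>artin_schreier_rootfree\<close>) of a subfield \<open>K\<close> is: \<open>K\<close> contains \<open>t\<close> and all roots of unity,
  and \<open>y\<^sup>p - y = t\<close> has no solution in \<open>K\<close>.

  Start. Let \<open>R\<close> be the field of all elements algebraic over \<open>F\<close>. It contains the roots of unity, and \<open>t\<close>
  is still transcendental over it, since algebraicity is transitive (\<open>transcendental_over_algebraics\<close>).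
  The field \<open>R(t)\<close> satisfies the invariant: if \<open>y = f/g\<close>, then \<open>f\<^sup>p = f g\<^bsup>p-1\<^esup> + t g\<^sup>p\<close> as polynomials,
  and comparing degrees is contradictory (\<open>rational_functions_rootfree\<close>).

  Radical step. Let \<open>r\<^sup>m \<in> K\<close> and suppose that \<open>y \<in> K(r)\<close>. If \<open>p\<close> divides \<open>m\<close>, then
  \<open>y\<^sup>p \<in> K(r\<^sup>p)\<close> by Frobenius, so \<open>y = y\<^sup>p - t \<in> K(r\<^sup>p)\<close> and \<open>m\<close> can be replaced by \<open>m/p\<close>.
  Otherwise take \<open>m\<close> minimal, still prime to \<open>p\<close>. As \<open>K\<close> contains the roots of unity, \<open>X\<^sup>m - r\<^sup>m\<close> is
  irreducible over \<open>K\<close>: the constant coefficient of a factor of degree \<open>d\<close> is a nonzero element of \<open>K\<close> times \<open>r\<^sup>d\<close>.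
  Hence \<open>1, r, \<dots>, r\<^bsup>m-1\<^esup>\<close> is a basis of \<open>K(r)\<close> over \<open>K\<close>. Write \<open>y = \<Sum>c\<^sub>i r\<^sup>i\<close>. Then
  \<open>y\<^sup>p = \<Sum>c\<^sub>i\<^sup>p r\<^bsup>pi\<^esup>\<close>, and since \<open>p\<close> is invertible modulo \<open>m\<close>, only \<open>i = 0\<close> contributes to the coordinate
  at \<open>1\<close>; comparing it in \<open>y\<^sup>p - y = t\<close> gives \<open>c\<^sub>0\<^sup>p - c\<^sub>0 = t\<close> with \<open>c\<^sub>0 \<in> K\<close>
  (\<open>artin_schreier_root_descends\<close>), which the invariant excludes.

  Chebyshev step. Write \<open>r = u + 1/u\<close>. The \<open>m\<close>-th Chebyshev power of \<open>r\<close> is \<open>a = u\<^sup>m + u\<^bsup>-m\<^esup>\<close>, so \<open>u\<^sup>m\<close> lies in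
  \<open>K(s)\<close> with \<open>s\<^sup>2 = a\<^sup>2 - 4 \<in> K\<close>, because \<open>p\<close> is odd. Two radical steps therefore reach a field that
  contains \<open>u\<close> and hence \<open>r\<close> (\<open>rootfree_chebyshev_extension\<close>).
\<close>

section \<open>Elements algebraic over a subfield\<close>

text \<open>
  The set of algebraic elements is obtained from the theory of finite extensions in rings with an
  explicit carrier. The lemmas on \<open>type_ring\<close> translate the notions involved for a type of class
  \<open>field\<close>, regarded as such a ring.
\<close>

abbreviation type_ring :: "'a::field ring" where
  "type_ring \<equiv> ring_of_type_algebra"

lemma type_ring_simps [simp]:
  "carrier type_ring = UNIV" "x \<otimes>\<^bsub>type_ring\<^esub> y = x * y" "\<one>\<^bsub>type_ring\<^esub> = 1"
  "\<zero>\<^bsub>type_ring\<^esub> = 0" "x \<oplus>\<^bsub>type_ring\<^esub> y = x + y"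
  by (auto simp: ring_of_type_algebra_def)

lemma a_inv_type_ring [simp]: "\<ominus>\<^bsub>type_ring\<^esub> x = - (x :: 'a::field)"
proof -
  interpret field "type_ring :: 'a ring" by rule
  show ?thesis by (rule minus_equality) auto
qed

lemma m_inv_type_ring: "x \<noteq> 0 \<Longrightarrow> inv\<^bsub>type_ring\<^esub> x = inverse (x :: 'a::field)"
proof -
  assume "x \<noteq> 0"
  interpret field "type_ring :: 'a ring" by rule
  show ?thesis using \<open>x \<noteq> 0\<close> by (intro comm_inv_char) auto
qed

lemma nat_pow_type_ring [simp]: "x [^]\<^bsub>type_ring\<^esub> (n::nat) = (x :: 'a::field) ^ n"
proof -
  interpret field "type_ring :: 'a ring" by rule
  show ?thesis by (induction n) (auto simp: mult.commute)
qed

lemma subfield_type_ring_iff: "subfield K type_ring \<longleftrightarrow> is_subfield (K :: 'a::field set)"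
proof
  interpret field "type_ring :: 'a ring" by rule
  assume K: "is_subfield K"
  show "subfield K type_ring"
  proof (rule subfieldI'[OF subringI])
    show "\<ominus>\<^bsub>type_ring\<^esub> h \<in> K" if "h \<in> K" for h
      using that K unfolding is_subfield_def by simp (metis diff_0)
  qed (use K in \<open>auto simp: is_subfield_def m_inv_type_ring\<close>)
next
  interpret field "type_ring :: 'a ring" by rule
  assume K: "subfield K type_ring"
  note S = subringE[OF subfieldE(1)[OF K]]
  have "x - y \<in> K" if "x \<in> K" "y \<in> K" for x y
    using S(7)[OF that(1) S(5)[OF that(2)]] by simp
  moreover have "inverse x \<in> K" if "x \<in> K" for x
    using that subfield_m_inv(1)[OF K, of x] m_inv_type_ring[of x]
    by (cases "x = 0") auto
  ultimately show "is_subfield K"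
    using S unfolding is_subfield_def by auto
qed

lemma eval_type_ring: "ring.eval type_ring p x = poly (Poly (rev p)) (x :: 'a::field)"
proof -
  interpret field "type_ring :: 'a ring" by rule
  show ?thesis
    by (induction p) (auto simp: Poly_append poly_monom mult.commute)
qed

lemma algebraic_type_ring_iff:
  fixes x :: "'a::field"
  assumes "is_subfield K"
  shows "(ring.algebraic type_ring over K) x \<longleftrightarrow> \<not> transcendental_over K x"
proof
  interpret field "type_ring :: 'a ring" by rule
  have K: "subring K type_ring"
    using assms subfieldE(1) subfield_type_ring_iff by blast
  {
    assume "(algebraic over K) x"
    then obtain p where p: "p \<in> carrier (K[X]\<^bsub>type_ring\<^esub>)" "p \<noteq> []" "eval p x = 0"
      using algebraicE[OF K, of x] by auto
    have "set p \<subseteq> K" "hd p \<noteq> 0"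
      using p by (auto simp: univ_poly_def polynomial_def)
    have "coeffs (Poly (rev p)) = rev p"
      using \<open>hd p \<noteq> 0\<close> p(2) by (cases p) auto
    hence "set (coeffs (Poly (rev p))) \<subseteq> K" "Poly (rev p) \<noteq> 0"
      using \<open>set p \<subseteq> K\<close> p(2) by (auto simp flip: coeffs_eq_Nil)
    thus "\<not> transcendental_over K x"
      using p(3) unfolding eval_type_ring transcendental_over_def by blast
  }
  {
    assume "\<not> transcendental_over K x"
    then obtain q where q: "set (coeffs q) \<subseteq> K" "poly q x = 0" "q \<noteq> 0"
      by (auto simp: transcendental_over_def)
    have "rev (coeffs q) \<in> carrier (K[X]\<^bsub>type_ring\<^esub>)"
      using q by (auto simp: univ_poly_def polynomial_def hd_rev last_coeffs_eq_coeff_degree)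
    thus "(algebraic over K) x"
      by (rule algebraicI) (use q in \<open>auto simp: eval_type_ring\<close>)
  }
qed

lemma is_subfield_algebraics:
  fixes K :: "'a::field set"
  assumes "is_subfield K"
  shows "is_subfield {x. \<not> transcendental_over K x}"
proof -
  interpret field "type_ring :: 'a ring" by rule
  have "subfield {x \<in> carrier type_ring. (algebraic over K) x} type_ring"
    using assms by (intro subfield_of_algebraics) (simp add: subfield_type_ring_iff)
  thus ?thesis
    using assms by (simp add: subfield_type_ring_iff algebraic_type_ring_iff)
qed

text \<open>
  The coefficients of an algebraic equation for \<open>t\<close> generate a finite extension \<open>E\<close> of \<open>K\<close>, so \<open>E(t)\<close> is
  finite over \<open>K\<close> and \<open>t\<close> is algebraic over \<open>K\<close>.
\<close>

lemma transcendental_over_algebraics: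
  fixes K :: "'a::field set"
  assumes K: "is_subfield K" and t: "transcendental_over K t"
  shows "transcendental_over {x. \<not> transcendental_over K x} t"
proof (rule ccontr)
  interpret field "type_ring :: 'a ring" by rule
  have K': "subfield K type_ring"
    using K by (simp add: subfield_type_ring_iff)
  assume "\<not> transcendental_over {x. \<not> transcendental_over K x} t"
  then obtain q where q: "set (coeffs q) \<subseteq> {x. \<not> transcendental_over K x}" "q \<noteq> 0" "poly q t = 0"
    by (auto simp: transcendental_over_def)
  define E where "E = finite_extension K (coeffs q)"
  have alg: "(algebraic over K) x" if "x \<in> set (coeffs q)" for x
    using that q(1) K by (auto simp: algebraic_type_ring_iff)
  have E: "subfield E type_ring" "finite_dimension K E"
    unfolding E_def using finite_extension_is_subfield[OF K' _ alg]
      finite_extension_finite_dimension(1)[OF K' _ alg] by auto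
  have "set (coeffs q) \<subseteq> E"
    unfolding E_def using finite_extension_mem[OF subfieldE(1)[OF K']] by auto
  hence "(algebraic over E) t"
    using q E(1) unfolding subfield_type_ring_iff
    by (subst algebraic_type_ring_iff) (auto simp: transcendental_over_def)
  hence "finite_dimension E (simple_extension E t)"
    using finite_dimension_simple_extension[OF E(1)] by simp
  hence "finite_dimension K (simple_extension E t)"
    using telescopic_base_dim(1)[OF K' E] by blast
  moreover have "subring (simple_extension E t) type_ring"
    using simple_extension_is_subring subfieldE(1)[OF E(1)] by simp
  moreover have "t \<in> simple_extension E t"
    using simple_extension_mem subfieldE(1)[OF E(1)] by simp
  ultimately have "(algebraic over K) t"
    using finite_dimension_imp_algebraic[OF K'] by blast
  thus False
    using t K by (simp add: algebraic_type_ring_iff)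
qed

text \<open>From here on these names refer to primes in types and to the type of polynomials.\<close>

hide_const (open) Divisibility.prime
  UnivPoly.monom UnivPoly.coeff

section \<open>Subfields and polynomials over them\<close>

lemma is_subfieldD:
  assumes "is_subfield K"
  shows "0 \<in> K" "1 \<in> K" "x \<in> K \<Longrightarrow> y \<in> K \<Longrightarrow> x + y \<in> K" "x \<in> K \<Longrightarrow> y \<in> K \<Longrightarrow> x - y \<in> K"
    "x \<in> K \<Longrightarrow> y \<in> K \<Longrightarrow> x * y \<in> K" "x \<in> K \<Longrightarrow> inverse x \<in> K"
  using assms by (auto simp: is_subfield_def)

lemma is_subfield_uminus: "is_subfield K \<Longrightarrow> x \<in> K \<Longrightarrow> - x \<in> K"
  using is_subfieldD(4)[of K 0 x] is_subfieldD(1)[of K] by simp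

lemma is_subfield_divide: "is_subfield K \<Longrightarrow> x \<in> K \<Longrightarrow> y \<in> K \<Longrightarrow> x / y \<in> K"
  by (simp add: divide_inverse is_subfieldD)

lemma is_subfield_power: "is_subfield K \<Longrightarrow> x \<in> K \<Longrightarrow> x ^ n \<in> K"
  by (induction n) (auto simp: is_subfieldD)

lemma is_subfield_sum: "is_subfield K \<Longrightarrow> (\<And>i. i \<in> I \<Longrightarrow> f i \<in> K) \<Longrightarrow> (\<Sum>i\<in>I. f i) \<in> K"
  by (induction I rule: infinite_finite_induct) (auto simp: is_subfieldD)

lemma is_subfield_prod_mset:
  "is_subfield K \<Longrightarrow> (\<And>x. x \<in># A \<Longrightarrow> f x \<in> K) \<Longrightarrow> (\<Prod>x\<in>#A. f x) \<in> K"
  by (induction A) (auto simp: is_subfieldD)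

lemma is_subfield_of_nat: "is_subfield K \<Longrightarrow> of_nat n \<in> K"
  by (induction n) (auto simp: is_subfieldD)

lemmas is_subfield_closed =
  is_subfieldD is_subfield_uminus is_subfield_divide is_subfield_power is_subfield_sum is_subfield_of_nat

lemma subset_field_adjoin: "K \<subseteq> field_adjoin K x"
  and adjoined_in_field_adjoin: "x \<in> field_adjoin K x"
  using hull_subset[of "insert x K" is_subfield] by (auto simp: field_adjoin_def)

lemma field_adjoin_minimal: "is_subfield L \<Longrightarrow> K \<subseteq> L \<Longrightarrow> x \<in> L \<Longrightarrow> field_adjoin K x \<subseteq> L"
  unfolding field_adjoin_def by (rule hull_minimal) auto

text \<open>
  The polynomials with all coefficients in \<open>K\<close>, as elements of the polynomial ring over the ambient
  ring. The coefficients beyond the degree count as well, so a nonempty set of this kind forces \<open>0 \<in> K\<close>.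
\<close>

definition polys_over :: "'a::comm_ring_1 set \<Rightarrow> 'a poly set" where
  "polys_over K = {f. \<forall>i. coeff f i \<in> K}"

lemma polys_over_iff: "is_subfield K \<Longrightarrow> f \<in> polys_over K \<longleftrightarrow> set (coeffs f) \<subseteq> K"
proof -
  assume K: "is_subfield K"
  show ?thesis
  proof
    assume "f \<in> polys_over K"
    thus "set (coeffs f) \<subseteq> K"
      by (auto simp: polys_over_def coeffs_def)
  next
    assume *: "set (coeffs f) \<subseteq> K"
    have "coeff f i \<in> K" for i
      using * coeff_in_coeffs[of f i] is_subfieldD(1)[OF K]
      by (cases "f = 0 \<or> i > degree f") (auto simp: coeff_eq_0)
    thus "f \<in> polys_over K"
      by (simp add: polys_over_def)
  qed
qed

context
  fixes K :: "'a::field set"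
  assumes K: "is_subfield K"
begin

lemma polys_over_0: "0 \<in> polys_over K"
  and polys_over_1: "1 \<in> polys_over K"
  and polys_over_add: "f \<in> polys_over K \<Longrightarrow> g \<in> polys_over K \<Longrightarrow> f + g \<in> polys_over K"
  and polys_over_diff: "f \<in> polys_over K \<Longrightarrow> g \<in> polys_over K \<Longrightarrow> f - g \<in> polys_over K"
  and polys_over_uminus: "f \<in> polys_over K \<Longrightarrow> - f \<in> polys_over K"
  and polys_over_mult: "f \<in> polys_over K \<Longrightarrow> g \<in> polys_over K \<Longrightarrow> f * g \<in> polys_over K"
  and polys_over_pCons: "c \<in> K \<Longrightarrow> f \<in> polys_over K \<Longrightarrow> pCons c f \<in> polys_over K"
  and polys_over_monom: "c \<in> K \<Longrightarrow> monom c n \<in> polys_over K"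
  using K by (auto simp: polys_over_def is_subfield_closed coeff_mult coeff_pCons split: nat.splits)

lemma polys_over_smult: "c \<in> K \<Longrightarrow> f \<in> polys_over K \<Longrightarrow> smult c f \<in> polys_over K"
  using K by (auto simp: polys_over_def is_subfield_closed)

lemma polys_over_power: "f \<in> polys_over K \<Longrightarrow> f ^ n \<in> polys_over K"
  by (induction n) (auto simp: polys_over_1 polys_over_mult)

lemma polys_over_sum: "(\<And>i. i \<in> I \<Longrightarrow> f i \<in> polys_over K) \<Longrightarrow> (\<Sum>i\<in>I. f i) \<in> polys_over K"
  by (induction I rule: infinite_finite_induct) (auto simp: polys_over_0 polys_over_add)

lemma polys_over_div_mod:
  assumes "f \<in> polys_over K" "g \<in> polys_over K"
  shows "f div g \<in> polys_over K \<and> f mod g \<in> polys_over K"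
proof (cases "g = 0")
  case True
  thus ?thesis using assms by (simp add: polys_over_0)
next
  case False
  show ?thesis
    using assms(1)
  proof (induction f)
    case 0
    thus ?case by (simp add: polys_over_0)
  next
    case (pCons a f)
    have a: "a \<in> K" and f: "f \<in> polys_over K"
      using pCons.prems by (auto simp: polys_over_def coeff_pCons split: nat.splits)
    note IH = pCons.IH[OF f]
    define c where "c = coeff (pCons a (f mod g)) (degree g) / coeff g (degree g)"
    have r: "pCons a (f mod g) \<in> polys_over K"
      using a IH by (intro polys_over_pCons) auto
    have "c \<in> K"
      unfolding c_def using r assms(2) by (intro is_subfield_divide[OF K]) (auto simp: polys_over_def)
    have "pCons a f mod g = pCons a (f mod g) - smult c g"
      using False by (simp add: mod_pCons c_def Let_def)
    moreover have "pCons a f div g = pCons c (f div g)"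
      using False by (simp add: div_pCons_eq c_def)
    ultimately show ?case
      using IH r \<open>c \<in> K\<close> assms(2)
      by (simp add: polys_over_pCons polys_over_diff polys_over_smult)
  qed
qed

lemma poly_in_subfield: "f \<in> polys_over K \<Longrightarrow> x \<in> K \<Longrightarrow> poly f x \<in> K"
  using K unfolding poly_altdef polys_over_def by (auto intro!: is_subfield_closed)

end

lemmas polys_over_closed = polys_over_0 polys_over_1 polys_over_add polys_over_diff polys_over_uminus
  polys_over_mult polys_over_pCons polys_over_monom polys_over_smult polys_over_power polys_over_sum

section \<open>Radical extensions of fields containing the roots of unity\<close>

text \<open>All roots of unity of the ambient field, of every order.\<close>

definition contains_roots_of_unity :: "'a::field set \<Rightarrow> bool" where
  "contains_roots_of_unity K \<longleftrightarrow> (\<forall>n z. n > 0 \<longrightarrow> z ^ n = 1 \<longrightarrow> z \<in> K)"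

text \<open>
  The reason for the irreducibility of \<open>X\<^sup>m - r\<^sup>m\<close> for minimal \<open>m\<close>: all roots of a factor \<open>f\<close> have the form
  \<open>\<zeta> r\<close> with \<open>\<zeta> \<in> K\<close>, so the constant coefficient of \<open>f\<close> is a unit of \<open>K\<close> times \<open>r\<close> to the degree of \<open>f\<close>.
\<close>

lemma power_degree_in_subfield_of_dvd:
  fixes r :: "'a::alg_closed_field"
  assumes K: "is_subfield K" "contains_roots_of_unity K"
    and m: "m > 0" and r: "r \<noteq> 0"
    and f: "f \<in> polys_over K" "f \<noteq> 0" "f dvd monom 1 m - [:r ^ m:]"
  shows "r ^ degree f \<in> K"
proof -
  obtain A where A: "size A = degree f" "f = smult (lead_coeff f) (\<Prod>x\<in>#A. [:-x, 1:])"
    using alg_closed_imp_factorization[OF f(2)] by blast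
  have ratio: "x / r \<in> K" "x \<noteq> 0" if "x \<in># A" for x
  proof -
    have "poly f x = 0"
      using that by (subst A(2)) (auto simp: poly_prod_mset prod_mset_zero_iff)
    hence "poly (monom 1 m - [:r ^ m:]) x = 0"
      using f(3) by (metis dvdE mult_zero_left poly_mult)
    hence "x ^ m = r ^ m"
      by (simp add: poly_monom)
    hence "(x / r) ^ m = 1"
      using r by (simp add: power_divide)
    thus "x / r \<in> K"
      using K(2) m by (auto simp: contains_roots_of_unity_def)
    show "x \<noteq> 0"
      using \<open>x ^ m = r ^ m\<close> r m by (auto simp: power_0_left)
  qed
  define c where "c = lead_coeff f * (\<Prod>x\<in>#A. - (x / r))"
  have "c \<in> K"
    unfolding c_def using f(1) ratio
    by (intro is_subfieldD(5)[OF K(1)] is_subfield_prod_mset[OF K(1)] is_subfield_uminus[OF K(1)])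
       (auto simp: polys_over_def)
  have "c \<noteq> 0"
    using f(2) ratio(2) r by (auto simp: c_def prod_mset_zero_iff)
  have "(\<Prod>x\<in>#B. - x) = (\<Prod>x\<in>#B. - (x / r)) * r ^ size B" for B
    using r by (induction B) (auto simp: field_simps)
  hence "poly f 0 = c * r ^ degree f"
    by (subst A(2)) (simp add: poly_prod_mset c_def A(1) image_mset.compositionality o_def)
  hence "r ^ degree f = poly f 0 / c"
    using \<open>c \<noteq> 0\<close> by simp
  thus ?thesis
    using \<open>c \<in> K\<close> f(1) K(1) by (simp add: is_subfield_divide poly_in_subfield is_subfieldD)
qed

text \<open>
  A nonzero radical \<open>r\<close> over a field \<open>K\<close> with all roots of unity, and the least positive exponent \<open>m\<close> that takes
  it into \<open>K\<close>. The case \<open>m = 1\<close>, that is \<open>r \<in> K\<close>, is included.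
\<close>

locale minimal_radical =
  fixes K :: "'a::alg_closed_field set" and r :: 'a and m :: nat
  assumes K: "is_subfield K" "contains_roots_of_unity K"
    and m: "m > 0" "r ^ m \<in> K" "\<And>k. 0 < k \<Longrightarrow> k < m \<Longrightarrow> r ^ k \<notin> K"
    and r: "r \<noteq> 0"
begin

text \<open>
  This single statement contains both the linear independence of \<open>1, r, \<dots>, r\<^bsup>m-1\<^esup>\<close> and the fact that the
  values at \<open>r\<close> of polynomials over \<open>K\<close> form a field.
\<close>

lemma invertible_poly_value:
  assumes "f \<in> polys_over K" "f \<noteq> 0" "degree f < m"
  shows "\<exists>u \<in> polys_over K. poly u r * poly f r = 1"
  using assms
proof (induction "degree f" arbitrary: f rule: less_induct)
  case (less f)
  show ?case
  proof (cases "degree f = 0")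
    case True
    then obtain c where c: "f = [:c:]" "c \<noteq> 0"
      using less.prems(2) by (metis degree_eq_zeroE pCons_eq_0_iff)
    hence "[:inverse c:] \<in> polys_over K"
      using less.prems(1) K(1)
      by (intro polys_over_closed is_subfieldD) (auto simp: polys_over_def coeff_pCons split: nat.splits)
    thus ?thesis
      using c by (intro bexI[of _ "[:inverse c:]"]) auto
  next
    case False
    define G where "G = monom 1 m - [:r ^ m:]"
    have G: "G \<in> polys_over K"
      unfolding G_def using K(1) m(2) by (intro polys_over_closed) (auto simp: is_subfieldD)
    note dm = polys_over_div_mod[OF K(1) G less.prems(1)]
    \<comment> \<open>As \<open>f\<close> does not divide \<open>G\<close>, the remainder of \<open>G\<close> modulo \<open>f\<close> is nonzero of smaller degree, and its
      value at \<open>r\<close> is a multiple of that of \<open>f\<close> because \<open>G\<close> vanishes at \<open>r\<close>.\<close>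
    have "\<not> f dvd G"
      using power_degree_in_subfield_of_dvd[OF K m(1) r less.prems(1,2)] m(3)[of "degree f"]
        False less.prems(3) by (auto simp: G_def)
    hence "G mod f \<noteq> 0"
      by (auto simp: mod_eq_0_iff_dvd)
    moreover have "degree (G mod f) < degree f"
      using False less.prems(2) by (intro degree_mod_less') (auto simp: \<open>G mod f \<noteq> 0\<close>)
    ultimately obtain u where u: "u \<in> polys_over K" "poly u r * poly (G mod f) r = 1"
      using less.hyps[of "G mod f"] dm less.prems(3) by auto
    have "poly (G mod f) r = poly (G - G div f * f) r"
      by (simp add: minus_div_mult_eq_mod)
    also have "\<dots> = - (poly (G div f) r * poly f r)"
      by (simp add: G_def poly_monom)
    finally have "poly (- (u * (G div f))) r * poly f r = 1"
      using u(2) by (simp add: mult_ac)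
    moreover have "- (u * (G div f)) \<in> polys_over K"
      using K(1) u(1) dm by (intro polys_over_closed) auto
    ultimately show ?thesis by blast
  qed
qed

lemma poly_eq_0_imp_eq_0:
  assumes "f \<in> polys_over K" "degree f < m" "poly f r = 0"
  shows "f = 0"
  using invertible_poly_value[of f] assms by auto

lemma field_adjoinE:
  assumes "y \<in> field_adjoin K r"
  obtains f where "f \<in> polys_over K" "degree f < m" "poly f r = y"
proof -
  define S where "S = (\<lambda>f. poly f r) ` polys_over K"
  have SI: "poly f r \<in> S" if "f \<in> polys_over K" for f
    using that by (simp add: S_def)
  have red: "\<exists>f \<in> polys_over K. degree f < m \<and> poly f r = y" if yS: "y \<in> S" for y
  proof -
    obtain g where g: "g \<in> polys_over K" "y = poly g r"
      using yS unfolding S_def by blast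
    define G where "G = monom 1 m - [:r ^ m:]"
    have G: "G \<in> polys_over K"
      unfolding G_def using K(1) m(2) by (intro polys_over_closed) (auto simp: is_subfieldD)
    have "degree G = m"
      unfolding G_def using m(1) by (intro antisym degree_le le_degree) (auto simp: coeff_pCons split: nat.splits)
    have "G \<noteq> 0" using \<open>degree G = m\<close> m(1) by auto
    have "degree (g mod G) < m"
      using degree_mod_less[OF \<open>G \<noteq> 0\<close>, of g] \<open>degree G = m\<close> m(1) by auto
    moreover have "poly (g mod G) r = poly (g - g div G * G) r"
      by (simp add: minus_div_mult_eq_mod)
    hence "poly (g mod G) r = y"
      using g by (simp add: G_def poly_monom)
    ultimately show ?thesis
      using polys_over_div_mod[OF K(1) g(1) G] by blast
  qed
  have "is_subfield S"
    unfolding is_subfield_def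
  proof (intro conjI ballI)
    show "0 \<in> S" "1 \<in> S"
      using SI[OF polys_over_0[OF K(1)]] SI[OF polys_over_1[OF K(1)]] by simp_all
  next
    fix x y assume "x \<in> S" "y \<in> S"
    then obtain f g where "f \<in> polys_over K" "g \<in> polys_over K" "x = poly f r" "y = poly g r"
      by (auto simp: S_def)
    thus "x + y \<in> S" "x - y \<in> S" "x * y \<in> S"
      using SI[of "f + g"] SI[of "f - g"] SI[of "f * g"] K(1) by (simp_all add: polys_over_closed)
  next
    fix x assume "x \<in> S"
    then obtain f where f: "f \<in> polys_over K" "degree f < m" "poly f r = x"
      using red by blast
    show "inverse x \<in> S"
    proof (cases "f = 0")
      case True
      thus ?thesis using f SI[OF f(1)] by simp
    next
      case False
      then obtain u where u: "u \<in> polys_over K" "poly u r * x = 1"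
        using invertible_poly_value[of f] f by auto
      hence "inverse x = poly u r"
        by (metis inverse_unique mult.commute)
      thus ?thesis using SI[OF u(1)] by simp
    qed
  qed
  moreover have "c \<in> S" if "c \<in> K" for c
    using that K(1) SI[of "[:c:]"] by (simp add: polys_over_closed)
  moreover have "r \<in> S"
    using K(1) SI[of "[:0, 1:]"] by (simp add: polys_over_closed is_subfieldD)
  ultimately have "field_adjoin K r \<subseteq> S"
    by (intro field_adjoin_minimal) auto
  thus ?thesis
    using assms red that by blast
qed

lemma artin_schreier_root_descends:
  assumes p: "prime p" "CHAR('a) = p" "coprime p m"
    and t: "t \<in> K" and y: "y \<in> field_adjoin K r" "y ^ p - y = t"
  shows "\<exists>c\<in>K. c ^ p - c = t"
proof -
  obtain f where f: "f \<in> polys_over K" "degree f < m" "poly f r = y"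
    using field_adjoinE[OF y(1)] .
  define a where "a = r ^ m"
  define c where "c = coeff f"
  have cK: "c i \<in> K" for i
    using f(1) by (auto simp: polys_over_def c_def)
  \<comment> \<open>The equation \<open>y\<^sup>p - y - t = 0\<close>, with every power of \<open>r\<close> reduced to an exponent below \<open>m\<close>.\<close>
  define h where "h = (\<Sum>i<m. monom (c i ^ p * a ^ (p * i div m)) (p * i mod m)) - f - [:t:]"
  have y_eq: "y = (\<Sum>i<m. c i * r ^ i)"
    unfolding f(3)[symmetric] poly_altdef c_def
    by (rule sum.mono_neutral_left) (use f(2) in \<open>auto simp: coeff_eq_0 not_le\<close>)
  have "y ^ p = (\<Sum>i<m. (c i * r ^ i) ^ p)"
    unfolding y_eq using p(1,2) by (intro freshmans_dream_sum) auto
  also have "\<dots> = (\<Sum>i<m. c i ^ p * a ^ (p * i div m) * r ^ (p * i mod m))"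
  proof (rule sum.cong)
    fix i
    have "(r ^ i) ^ p = r ^ (m * (p * i div m) + p * i mod m)"
      by (simp add: mult.commute flip: power_mult)
    also have "\<dots> = a ^ (p * i div m) * r ^ (p * i mod m)"
      by (simp only: power_add power_mult a_def)
    finally show "(c i * r ^ i) ^ p = c i ^ p * a ^ (p * i div m) * r ^ (p * i mod m)"
      by (simp add: power_mult_distrib mult.assoc)
  qed auto
  finally have "poly h r = 0"
    using y(2) f(3) by (simp add: h_def poly_sum poly_monom)
  moreover have "h \<in> polys_over K"
    unfolding h_def using K(1) cK t f(1) m(2)
    by (intro polys_over_closed) (auto simp: is_subfield_closed a_def)
  moreover have "degree h < m"
  proof -
    have "degree (\<Sum>i<m. monom (c i ^ p * a ^ (p * i div m)) (p * i mod m)) \<le> m - 1"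
    proof (rule degree_sum_le)
      fix i
      have "p * i mod m \<le> m - 1"
        using m(1) by (simp add: less_eq_Suc_le[symmetric] Suc_diff_1 flip: less_Suc_eq_le)
      thus "degree (monom (c i ^ p * a ^ (p * i div m)) (p * i mod m)) \<le> m - 1"
        using degree_monom_le order_trans by blast
    qed auto
    hence "degree h \<le> m - 1"
      unfolding h_def using f(2) by (intro degree_diff_le) auto
    thus ?thesis using m(1) by linarith
  qed
  ultimately have "h = 0"
    using poly_eq_0_imp_eq_0 by blast
  hence "0 = coeff h 0" by simp
  also have "\<dots> = (\<Sum>i<m. if p * i mod m = 0 then c i ^ p * a ^ (p * i div m) else 0) - c 0 - t"
    by (simp add: h_def coeff_sum) (simp add: c_def)
  also have "(\<Sum>i<m. if p * i mod m = 0 then c i ^ p * a ^ (p * i div m) else 0) =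
             (\<Sum>i<m. if i = 0 then c 0 ^ p else 0)"
  proof (rule sum.cong)
    fix i assume "i \<in> {..<m}"
    have "p * i mod m = 0 \<longleftrightarrow> m dvd i"
      using p(3) by (simp add: mod_eq_0_iff_dvd coprime_dvd_mult_right_iff coprime_commute)
    also have "\<dots> \<longleftrightarrow> i = 0"
      using \<open>i \<in> {..<m}\<close> by (auto dest: dvd_imp_le)
    finally show "(if p * i mod m = 0 then c i ^ p * a ^ (p * i div m) else 0) = (if i = 0 then c 0 ^ p else 0)"
      by auto
  qed auto
  also have "\<dots> = c 0 ^ p"
    using m(1) by simp
  finally show ?thesis
    using cK[of 0] by (intro bexI[of _ "c 0"]) auto
qed

end

section \<open>Fields without a root of the Artin-Schreier polynomial\<close>

text \<open>
  The invariant that is carried along towers: \<open>K\<close> is a subfield that contains \<open>t\<close> and the roots of unity of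
  the ambient field, but no root of \<open>x\<^sup>p - x - t\<close>.
\<close>
definition artin_schreier_rootfree :: "nat \<Rightarrow> 'a::field \<Rightarrow> 'a set \<Rightarrow> bool" where
  "artin_schreier_rootfree p t K \<longleftrightarrow> is_subfield K \<and> contains_roots_of_unity K \<and> t \<in> K \<and>
     (\<forall>y\<in>K. y ^ p - y \<noteq> t)"

lemma freshmans_dream_diff:
  fixes x y :: "'a::comm_ring_1"
  assumes "prime p" "CHAR('a) = p"
  shows "(x - y) ^ p = x ^ p - y ^ p"
proof -
  have "(x - y + y) ^ p = (x - y) ^ p + y ^ p"
    using assms by (intro freshmans_dream) auto
  thus ?thesis by simp
qed

lemma no_root_in_radical_extension:
  fixes K :: "'a::alg_closed_field set"
  assumes p: "prime p" "CHAR('a) = p" and K: "artin_schreier_rootfree p t K"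
    and "m > 0" "r ^ m \<in> K" "y \<in> field_adjoin K r"
  shows "y ^ p - y \<noteq> t"
  using assms(4-)
proof (induction m arbitrary: r y rule: less_induct)
  case (less m)
  have K': "is_subfield K" "contains_roots_of_unity K" "t \<in> K" "\<And>y. y \<in> K \<Longrightarrow> y ^ p - y \<noteq> t"
    using K by (auto simp: artin_schreier_rootfree_def)
  show ?case
  proof
    assume y: "y ^ p - y = t"
    hence "y \<notin> K"
      using K' by blast
    hence "r \<notin> K"
      using field_adjoin_minimal[OF K'(1), of K r] less.prems(3) by auto
    hence "r \<noteq> 0"
      using is_subfieldD(1)[OF K'(1)] by auto
    show False
    proof (cases "p dvd m")
      case True
      then obtain k where k: "m = p * k" by blast
      \<comment> \<open>The elements whose \<open>p\<close>-th power lies in \<open>E\<close> form a field, since Frobenius is a homomorphism.\<close>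
      define E where "E = field_adjoin K (r ^ p)"
      have E: "is_subfield E" "K \<subseteq> E" "r ^ p \<in> E"
        unfolding E_def by (simp_all add: is_subfield_field_adjoin subset_field_adjoin adjoined_in_field_adjoin)
      have "is_subfield {z. z ^ p \<in> E}"
        using E(1) p unfolding is_subfield_def mem_Collect_eq
        by (auto simp: freshmans_dream freshmans_dream_diff power_mult_distrib power_inverse
              power_0_left prime_gt_0_nat)
      moreover have "K \<subseteq> {z. z ^ p \<in> E}"
        using E(2) is_subfield_power[OF E(1)] by auto
      ultimately have "field_adjoin K r \<subseteq> {z. z ^ p \<in> E}"
        using E(3) by (intro field_adjoin_minimal) auto
      hence "y ^ p \<in> E"
        using less.prems(3) by auto
      moreover have "y = y ^ p - t"
        using y by (simp add: algebra_simps)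
      ultimately have "y \<in> E"
        using E(1,2) K'(3) is_subfieldD(4)[OF E(1), of "y ^ p" t] by auto
      moreover have "k < m" "k > 0"
        using k less.prems(1) prime_gt_1_nat[OF p(1)] by auto
      moreover have "(r ^ p) ^ k \<in> K"
        using less.prems(2) by (simp add: k power_mult)
      ultimately show False
        using less.IH[of k "r ^ p" y] y unfolding E_def by blast
    next
      case False
      define n where "n = (LEAST n. n > 0 \<and> r ^ n \<in> K)"
      have n: "n > 0" "r ^ n \<in> K"
        using LeastI[of "\<lambda>n. n > 0 \<and> r ^ n \<in> K" m] less.prems by (auto simp: n_def)
      have n_min: "r ^ k \<notin> K" if "0 < k" "k < n" for k
        using not_less_Least[of k "\<lambda>n. n > 0 \<and> r ^ n \<in> K"] that by (auto simp: n_def)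
      have "r ^ m = (r ^ n) ^ (m div n) * r ^ (m mod n)"
        by (simp flip: power_mult power_add)
      hence "r ^ (m mod n) = r ^ m / (r ^ n) ^ (m div n)"
        using \<open>r \<noteq> 0\<close> by simp
      hence "r ^ (m mod n) \<in> K"
        using n(2) less.prems(2) K'(1) by (simp add: is_subfield_divide is_subfield_power)
      hence "n dvd m"
        using n_min[of "m mod n"] n(1) by (auto simp: mod_greater_zero_iff_not_dvd)
      hence "coprime p n"
        using False p(1) by (metis dvd_trans prime_imp_coprime)
      interpret minimal_radical K r n
        using K' n n_min \<open>r \<noteq> 0\<close> by unfold_locales
      show False
        using artin_schreier_root_descends[OF p \<open>coprime p n\<close> K'(3) less.prems(3) y] K'(4) by blast
    qed
  qed
qed

lemma rootfree_radical_extension: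
  fixes K :: "'a::alg_closed_field set"
  assumes "prime p" "CHAR('a) = p" "artin_schreier_rootfree p t K" "m > 0" "r ^ m \<in> K"
  shows "artin_schreier_rootfree p t (field_adjoin K r)"
  using no_root_in_radical_extension[OF assms] subset_field_adjoin[of K r] assms(3)
  by (auto simp: artin_schreier_rootfree_def contains_roots_of_unity_def is_subfield_field_adjoin)

lemma chebyshev_power_add_inverse:
  fixes u :: "'a::field"
  assumes "u \<noteq> 0"
  shows "chebyshev_power (u + inverse u) n = u ^ n + inverse u ^ n"
proof (induction n rule: less_induct)
  case (less n)
  consider "n = 0" | "n = 1" | k where "n = Suc (Suc k)"
    by (metis One_nat_def not0_implies_Suc)
  thus ?case
  proof cases
    case 3
    thus ?thesis
      using less.IH[of k] less.IH[of "Suc k"] assms by (simp add: field_simps)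
  qed auto
qed

lemma rootfree_chebyshev_extension:
  fixes K :: "'a::alg_closed_field set"
  assumes p: "prime p" "odd p" "CHAR('a) = p" and K: "artin_schreier_rootfree p t K"
    and m: "m > 0" "chebyshev_power r m \<in> K"
  shows "\<exists>L. artin_schreier_rootfree p t L \<and> K \<subseteq> L \<and> r \<in> L"
proof -
  have "(of_nat 2 :: 'a) \<noteq> 0"
    using p prime_gt_1_nat[OF p(1)] unfolding of_nat_eq_0_iff_char_dvd
    by (auto dest!: dvd_imp_le simp: le_Suc_eq numeral_2_eq_2)
  hence two: "(2 :: 'a) \<noteq> 0" by simp
  obtain u where u: "poly [:1, -r, 1:] u = 0"
    using alg_closed_imp_poly_has_root[of "[:1, -r, 1:]"] by auto
  hence "u \<noteq> 0" by auto
  have r: "r = u + inverse u"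
    using u \<open>u \<noteq> 0\<close> by (simp add: field_simps)
  define a where "a = chebyshev_power r m"
  define v where "v = u ^ m"
  have "v \<noteq> 0"
    using \<open>u \<noteq> 0\<close> by (simp add: v_def)
  have a: "a = v + inverse v"
    using \<open>u \<noteq> 0\<close> by (simp add: a_def r v_def chebyshev_power_add_inverse power_inverse)
  \<comment> \<open>\<open>v\<close> and \<open>1/v\<close> are the roots of \<open>X\<^sup>2 - a X + 1\<close>, and \<open>s\<close> is a square root of its discriminant.\<close>
  define s where "s = v - inverse v"
  define L1 where "L1 = field_adjoin K s"
  have KF: "is_subfield K"
    using K by (simp add: artin_schreier_rootfree_def)
  have "s ^ 2 = a ^ 2 - of_nat 4"
    using \<open>v \<noteq> 0\<close> by (simp add: s_def a field_simps power2_eq_square)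
  hence "s ^ 2 \<in> K"
    using m(2) KF by (simp add: a_def is_subfield_closed del: of_nat_numeral)
  hence L1: "artin_schreier_rootfree p t L1"
    unfolding L1_def using rootfree_radical_extension[OF p(1,3) K, of 2 s] by simp
  hence L1F: "is_subfield L1"
    by (simp add: artin_schreier_rootfree_def)
  have "a \<in> L1" "s \<in> L1"
    using m(2) subset_field_adjoin[of K s] by (auto simp: L1_def a_def adjoined_in_field_adjoin)
  moreover have "v = (a + s) / of_nat 2"
    using two by (simp add: a s_def)
  ultimately have "u ^ m \<in> L1"
    using L1F unfolding v_def[symmetric] by (simp add: is_subfield_closed del: of_nat_numeral)
  define L2 where "L2 = field_adjoin L1 u"
  have "artin_schreier_rootfree p t L2"
    unfolding L2_def by (rule rootfree_radical_extension[OF p(1,3) L1 m(1) \<open>u ^ m \<in> L1\<close>])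
  moreover have "K \<subseteq> L2"
    using subset_field_adjoin[of K s] subset_field_adjoin[of L1 u] by (auto simp: L1_def L2_def)
  moreover have "r \<in> L2"
    unfolding r L2_def
    by (intro is_subfieldD[OF is_subfield_field_adjoin] adjoined_in_field_adjoin)
  ultimately show ?thesis by blast
qed

section \<open>A starting field for the tower\<close>

lemma rational_functions_rootfree:
  fixes R :: "'a::field set"
  assumes R: "is_subfield R" "transcendental_over R t" and p: "p \<ge> 2"
    and y: "f \<in> polys_over R" "g \<in> polys_over R" "poly g t \<noteq> 0" "y = poly f t / poly g t"
  shows "y ^ p - y \<noteq> t"
proof
  assume eq: "y ^ p - y = t"
  obtain n where n: "p = Suc n" "n > 0"
    using p by (cases p) auto
  \<comment> \<open>\<open>h(t)\<close> is \<open>y\<^sup>p - y - t\<close> multiplied by \<open>g(t)\<^sup>p\<close>.\<close>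
  define h where "h = f ^ p - f * g ^ n - pCons 0 (g ^ p)"
  have "poly h t = (poly g t) ^ p * (y ^ p - y - t)"
    using y(3) by (simp add: h_def y(4) field_simps n)
  hence "poly h t = 0"
    using eq by simp
  moreover have "h \<in> polys_over R"
    unfolding h_def using R(1) y by (intro polys_over_closed) (auto simp: is_subfieldD)
  ultimately have "h = 0"
    using R by (auto simp: transcendental_over_def polys_over_iff)
  hence h: "f ^ p = f * g ^ n + pCons 0 (g ^ p)"
    by (simp add: h_def algebra_simps)
  have "g \<noteq> 0" using y(3) by auto
  hence deg1: "degree (pCons 0 (g ^ p)) = Suc (p * degree g)"
    by (simp add: degree_power_eq)
  have deg2: "degree (f * g ^ n) \<le> degree f + n * degree g"
    using degree_mult_le[of f "g ^ n"] \<open>g \<noteq> 0\<close> by (simp add: degree_power_eq)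
  show False
  proof (cases "degree f \<le> degree g")
    case True
    hence "degree (f * g ^ n) < degree (pCons 0 (g ^ p))"
      using deg1 deg2 n by simp
    hence "degree (f ^ p) = Suc (p * degree g)"
      unfolding h by (simp only: degree_add_eq_right deg1)
    moreover have "degree (f ^ p) \<le> p * degree f"
      using degree_power_le[of f p] by (simp add: mult.commute)
    moreover have "p * degree f \<le> p * degree g"
      using True by simp
    ultimately show False by linarith
  next
    case False
    then obtain d where d: "degree f = Suc (degree g + d)"
      by (metis less_imp_Suc_add not_le)
    hence "f \<noteq> 0" by auto
    hence "degree (f ^ p) = p * degree f"
      by (simp add: degree_power_eq)
    moreover have "degree (f ^ p) \<le> max (degree f + n * degree g) (Suc (p * degree g))"
      unfolding h using deg1 deg2 by (intro order_trans[OF degree_add_le_max]) auto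
    moreover have "degree f + n * degree g < p * degree f" "Suc (p * degree g) < p * degree f"
      using n unfolding d by (auto simp: algebra_simps)
    ultimately show False by linarith
  qed
qed

lemma exists_rootfree:
  fixes K :: "'a::field set"
  assumes K: "is_subfield K" "transcendental_over K t" and p: "p \<ge> 2"
  shows "\<exists>L. artin_schreier_rootfree p t L \<and> K \<subseteq> L"
proof -
  define R where "R = {x. \<not> transcendental_over K x}"
  have R: "is_subfield R" "transcendental_over R t"
    unfolding R_def using K by (auto intro: is_subfield_algebraics transcendental_over_algebraics)
  define L where "L = {poly f t / poly g t |f g. f \<in> polys_over R \<and> g \<in> polys_over R \<and> poly g t \<noteq> 0}"
  have LI: "poly f t / poly g t \<in> L" if "f \<in> polys_over R" "g \<in> polys_over R" for f g
  proof (cases "poly g t = 0")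
    case True
    thus ?thesis
      unfolding L_def mem_Collect_eq
      by (intro exI[of _ 0] exI[of _ 1]) (auto simp: polys_over_0[OF R(1)] polys_over_1[OF R(1)])
  qed (use that in \<open>auto simp: L_def\<close>)
  have L_polyI: "poly f t \<in> L" if "f \<in> polys_over R" for f
    using LI[OF that polys_over_1[OF R(1)]] by simp
  have "is_subfield L"
    unfolding is_subfield_def
  proof (intro conjI ballI)
    show "0 \<in> L" "1 \<in> L"
      using L_polyI[OF polys_over_0[OF R(1)]] L_polyI[OF polys_over_1[OF R(1)]] by auto
  next
    fix x y assume "x \<in> L" "y \<in> L"
    then obtain f g f' g' where *: "x = poly f t / poly g t" "f \<in> polys_over R" "g \<in> polys_over R" "poly g t \<noteq> 0"
      "y = poly f' t / poly g' t" "f' \<in> polys_over R" "g' \<in> polys_over R" "poly g' t \<noteq> 0"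
      unfolding L_def by blast
    have "x + y = poly (f * g' + f' * g) t / poly (g * g') t"
         "x - y = poly (f * g' - f' * g) t / poly (g * g') t"
         "x * y = poly (f * f') t / poly (g * g') t"
      unfolding *(1,5) using *(4,8) by (simp_all add: divide_simps)
    thus "x + y \<in> L" "x - y \<in> L" "x * y \<in> L"
      using R(1) * by (auto intro!: LI polys_over_closed simp del: poly_mult poly_add poly_diff)
  next
    fix x assume "x \<in> L"
    thus "inverse x \<in> L"
      using LI by (auto simp: L_def)
  qed
  have RL: "x \<in> L" if "x \<in> R" for x
    using L_polyI[of "[:x:]"] that R(1) by (simp add: polys_over_closed)
  have alg: "x \<in> R" if "set (coeffs q) \<subseteq> K" "q \<noteq> 0" "poly q x = 0" for q x
    using that by (auto simp: R_def transcendental_over_def)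
  have "K \<subseteq> R"
  proof
    fix x assume "x \<in> K"
    thus "x \<in> R"
      using K(1) by (intro alg[of "[:-x, 1:]"]) (auto simp: is_subfieldD is_subfield_uminus)
  qed
  moreover have "contains_roots_of_unity L"
    unfolding contains_roots_of_unity_def
  proof (intro allI impI)
    fix n z assume z: "n > 0" "z ^ n = (1::'a)"
    have "monom 1 n - 1 \<in> polys_over K"
      using K(1) by (intro polys_over_closed) (auto simp: is_subfieldD)
    moreover have "coeff (monom 1 n - 1) n = (1 :: 'a)"
      using z(1) by simp
    hence "monom 1 n - (1 :: 'a poly) \<noteq> 0"
      by (metis coeff_0 zero_neq_one)
    moreover have "poly (monom 1 n - 1) z = 0"
      using z by (simp add: poly_monom)
    ultimately show "z \<in> L"
      using alg[of "monom 1 n - 1" z] K(1) RL by (simp add: polys_over_iff)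
  qed
  moreover have "t \<in> L"
    using L_polyI[of "[:0, 1:]"] R(1) by (simp add: polys_over_closed is_subfieldD)
  moreover have "y ^ p - y \<noteq> t" if "y \<in> L" for y
    using that rational_functions_rootfree[OF R p] unfolding L_def by blast
  ultimately show ?thesis
    using \<open>is_subfield L\<close> RL unfolding artin_schreier_rootfree_def by blast
qed

section \<open>Embeddings of subfields\<close>

context
  fixes h :: "'a::field \<Rightarrow> 'b::field" and K :: "'a set"
  assumes K: "is_subfield K" and h: "is_field_embedding K h"
begin

lemma embedding_1: "h 1 = 1"
  and embedding_add: "x \<in> K \<Longrightarrow> y \<in> K \<Longrightarrow> h (x + y) = h x + h y"
  and embedding_mult: "x \<in> K \<Longrightarrow> y \<in> K \<Longrightarrow> h (x * y) = h x * h y"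
  using h by (auto simp: is_field_embedding_def)

lemma embedding_0: "h 0 = 0"
proof -
  have "h 0 + h 0 = h 0 + 0"
    using embedding_add[of 0 0] is_subfieldD(1)[OF K] by simp
  thus ?thesis
    by (simp only: add_left_cancel)
qed

lemma embedding_diff: "x \<in> K \<Longrightarrow> y \<in> K \<Longrightarrow> h (x - y) = h x - h y"
  using embedding_add[of "x - y" y] is_subfieldD(4)[OF K] by (simp add: algebra_simps)

lemma embedding_uminus: "x \<in> K \<Longrightarrow> h (- x) = - h x"
  using embedding_diff[of 0 x] embedding_0 is_subfieldD(1)[OF K] by simp

lemma embedding_inverse: "x \<in> K \<Longrightarrow> h (inverse x) = inverse (h x)"
  using embedding_mult[of x "inverse x"] embedding_0 embedding_1 is_subfieldD(6)[OF K]
  by (cases "x = 0") (auto simp: inverse_unique)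

lemma embedding_eq_0_iff: "x \<in> K \<Longrightarrow> h x = 0 \<longleftrightarrow> x = 0"
  using embedding_mult[of x "inverse x"] embedding_0 embedding_1 is_subfieldD(6)[OF K]
  by (cases "x = 0") auto

lemma embedding_of_nat: "h (of_nat n) = of_nat n"
  by (induction n) (auto simp: embedding_0 embedding_1 embedding_add is_subfield_of_nat K is_subfieldD)

lemma CHAR_embedding: "CHAR('b) = CHAR('a)"
proof (rule CHAR_eqI)
  show "of_nat CHAR('a) = (0 :: 'b)"
    using embedding_of_nat[of "CHAR('a)"] embedding_0 by simp
  show "CHAR('a) dvd n" if "of_nat n = (0 :: 'b)" for n
    using embedding_of_nat[of n] embedding_eq_0_iff[of "of_nat n"] that
      of_nat_eq_0_iff_char_dvd[of n, where ?'a = 'a] is_subfield_of_nat[OF K] by simp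
qed

lemma poly_map_poly_embedding:
  "f \<in> polys_over K \<Longrightarrow> x \<in> K \<Longrightarrow> poly (map_poly h f) (h x) = h (poly f x)"
proof (induction f)
  case 0
  thus ?case by (simp add: embedding_0)
next
  case (pCons a f)
  have "a \<in> K" "f \<in> polys_over K"
    using pCons.prems by (auto simp: polys_over_def coeff_pCons split: nat.splits)
  thus ?case
    using pCons K by (simp add: map_poly_pCons embedding_add embedding_mult embedding_0 is_subfield_closed poly_in_subfield)
qed

lemma is_subfield_embedding_vimage: "is_subfield L \<Longrightarrow> is_subfield {x \<in> K. h x \<in> L}"
  using K unfolding is_subfield_def mem_Collect_eq
  by (simp add: embedding_0 embedding_1 embedding_add embedding_mult embedding_diff embedding_inverse)

lemma is_subfield_embedding_image:
  assumes F: "is_subfield F" "F \<subseteq> K"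
  shows "is_subfield (h ` F)"
proof -
  have E: "h (x + y) = h x + h y" "h (x - y) = h x - h y" "h (x * y) = h x * h y"
    "h (inverse x) = inverse (h x)" if "x \<in> F" "y \<in> F" for x y
    using that F(2) by (auto intro: embedding_add embedding_diff embedding_mult embedding_inverse)
  show ?thesis
    unfolding is_subfield_def
  proof (intro conjI ballI)
    show "0 \<in> h ` F" "1 \<in> h ` F"
      using is_subfieldD(1,2)[OF F(1)] embedding_0 embedding_1 by (metis image_eqI)+
  next
    fix x y assume "x \<in> h ` F" "y \<in> h ` F"
    then obtain x' y' where xy: "x' \<in> F" "y' \<in> F" "x = h x'" "y = h y'" by blast
    show "x + y \<in> h ` F" "x - y \<in> h ` F" "x * y \<in> h ` F"
      using xy is_subfieldD(3-5)[OF F(1), of x' y'] by (simp_all flip: E)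
  next
    fix x assume "x \<in> h ` F"
    then obtain x' where "x' \<in> F" "x = h x'" by blast
    thus "inverse x \<in> h ` F"
      using is_subfieldD(6)[OF F(1), of x'] by (simp flip: E)
  qed
qed

lemma transcendental_over_embedding:
  assumes F: "is_subfield F" "F \<subseteq> K" and t: "t \<in> K" "transcendental_over F t"
  shows "transcendental_over (h ` F) (h t)"
  unfolding transcendental_over_def
proof (intro allI impI)
  fix q assume q: "set (coeffs q) \<subseteq> h ` F \<and> poly q (h t) = 0"
  define g where "g = inv_into F h"
  have inj: "inj_on h F"
  proof (rule inj_onI)
    fix x y assume "x \<in> F" "y \<in> F" "h x = h y"
    thus "x = y"
      using F(2) embedding_diff[of x y] embedding_eq_0_iff[of "x - y"] is_subfieldD(4)[OF K, of x y] by auto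
  qed
  have qF: "coeff q i \<in> h ` F" for i
    using q polys_over_iff[OF is_subfield_embedding_image[OF F], of q] by (auto simp: polys_over_def)
  have g0: "g 0 = 0"
    using inv_into_f_f[OF inj is_subfieldD(1)[OF F(1)]] by (simp add: g_def embedding_0)
  define f where "f = map_poly g q"
  have cf: "coeff f i = g (coeff q i)" for i
    by (simp add: f_def coeff_map_poly g0)
  have f: "f \<in> polys_over F"
    using qF inv_into_into[of _ h F] by (auto simp: polys_over_def cf g_def)
  have hf: "map_poly h f = q"
    by (rule poly_eqI) (use qF in \<open>simp add: coeff_map_poly embedding_0 cf g_def f_inv_into_f\<close>)
  have "f \<in> polys_over K"
    using f F(2) by (auto simp: polys_over_def)
  hence "h (poly f t) = 0"
    using poly_map_poly_embedding[of f t] t(1) q hf by simp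
  hence "poly f t = 0"
    using embedding_eq_0_iff poly_in_subfield[OF K \<open>f \<in> polys_over K\<close> t(1)] by blast
  hence "f = 0"
    using t(2) f F(1) by (auto simp: transcendental_over_def polys_over_iff)
  thus "q = 0"
    using hf by auto
qed

end

section \<open>Towers of radicals and Chebyshev radicals\<close>

text \<open>
  The common part of both assertions. The power operation is compared with its counterpart \<open>pow'\<close> on the
  algebraic closure, and \<open>step\<close> says that a field satisfying the invariant can be enlarged so as to contain a
  given radical. The tower is carried into the algebraic closure, and its fields are only shown to be
  contained in fields satisfying the invariant, which need not form a tower of simple extensions.
\<close>

lemma not_solvable_by_powers:
  fixes pow :: "'b::field \<Rightarrow> nat \<Rightarrow> 'b" and pow' :: "'b alg_closure \<Rightarrow> nat \<Rightarrow> 'b alg_closure"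
    and F :: "'a::field set"
  assumes p: "prime p" "CHAR('a) = p" and F: "is_subfield F" "transcendental_over F t"
    and pow: "\<And>x m. to_ac (pow x m) = pow' (to_ac x) m"
    and step: "\<And>s K r m. CHAR('b alg_closure) = p \<Longrightarrow> artin_schreier_rootfree p s K \<Longrightarrow> m > 0 \<Longrightarrow>
       pow' r m \<in> K \<Longrightarrow> \<exists>L. artin_schreier_rootfree p s L \<and> K \<subseteq> L \<and> r \<in> L"
  shows "\<not> solvable_by_powers pow (field_adjoin F t) (monom 1 p - monom 1 1 - [:t:])"
proof
  define F0 where "F0 = field_adjoin F t"
  assume "solvable_by_powers pow (field_adjoin F t) (monom 1 p - monom 1 1 - [:t:])"
  then obtain h :: "'a \<Rightarrow> 'b" and K n where h: "is_field_embedding F0 h" and K0: "K 0 = h ` F0"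
    and K: "\<And>i. i < n \<Longrightarrow> \<exists>r m. m > 0 \<and> pow r m \<in> K i \<and> K (Suc i) = field_adjoin (K i) r"
    and split: "splits_over (K n) (map_poly h (monom 1 p - monom 1 1 - [:t:]))"
    unfolding solvable_by_powers_def F0_def by blast
  have F0: "is_subfield F0" "F \<subseteq> F0" "t \<in> F0"
    unfolding F0_def by (simp_all add: is_subfield_field_adjoin subset_field_adjoin adjoined_in_field_adjoin)
  have ac: "is_field_embedding (UNIV :: 'b set) to_ac" and UNIV: "is_subfield (UNIV :: 'b set)"
    by (auto simp: is_field_embedding_def is_subfield_def)
  define h' where "h' = to_ac \<circ> h"
  have h': "is_field_embedding F0 h'"
    using h by (auto simp: is_field_embedding_def h'_def)
  have char: "CHAR('b alg_closure) = p"
    using CHAR_embedding[OF F0(1) h'] p(2) by simp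
  define s where "s = h' t"
  obtain L0 where L0: "artin_schreier_rootfree p s L0" "h' ` F \<subseteq> L0"
    unfolding s_def
    using exists_rootfree[OF is_subfield_embedding_image[OF F0(1) h' F(1) F0(2)]
        transcendental_over_embedding[OF F0(1) h' F(1) F0(2,3) F(2)] prime_ge_2_nat[OF p(1)]] by blast
  have tower: "\<exists>L. artin_schreier_rootfree p s L \<and> to_ac ` K i \<subseteq> L" if "i \<le> n" for i
    using that
  proof (induction i)
    case 0
    have "F0 \<subseteq> {x \<in> F0. h' x \<in> L0}"
      unfolding F0_def
    proof (rule field_adjoin_minimal, fold F0_def)
      show "is_subfield {x \<in> F0. h' x \<in> L0}"
        using L0(1) by (intro is_subfield_embedding_vimage[OF F0(1) h']) (simp add: artin_schreier_rootfree_def)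
    qed (use F0 L0 in \<open>auto simp: artin_schreier_rootfree_def s_def\<close>)
    thus ?case
      using L0(1) by (auto simp: K0 h'_def)
  next
    case (Suc i)
    then obtain L where L: "artin_schreier_rootfree p s L" "to_ac ` K i \<subseteq> L" by auto
    obtain r m where r: "m > 0" "pow r m \<in> K i" "K (Suc i) = field_adjoin (K i) r"
      using K[of i] Suc.prems by auto
    have "pow' (to_ac r) m \<in> L"
      using L(2) r(2) by (auto simp flip: pow)
    then obtain L' where L': "artin_schreier_rootfree p s L'" "L \<subseteq> L'" "to_ac r \<in> L'"
      using step[OF char L(1) r(1)] by blast
    have "is_subfield {x \<in> UNIV. to_ac x \<in> L'}"
      using L'(1) by (intro is_subfield_embedding_vimage[OF UNIV ac]) (simp add: artin_schreier_rootfree_def)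
    hence "K (Suc i) \<subseteq> {x \<in> UNIV. to_ac x \<in> L'}"
      unfolding r(3) using L' L(2) by (intro field_adjoin_minimal) auto
    thus ?case
      using L'(1) by blast
  qed
  then obtain L where L: "artin_schreier_rootfree p s L" "to_ac ` K n \<subseteq> L" by blast
  define P where "P = map_poly h (monom 1 p - monom 1 1 - [:t:])"
  have "p > 1"
    using prime_gt_1_nat[OF p(1)] .
  have P: "P = monom 1 p - monom 1 1 - [:h t:]"
    using F0(3) is_subfieldD(1,2)[OF F0(1)] \<open>p > 1\<close>
    by (intro poly_eqI)
       (auto simp: P_def coeff_map_poly coeff_pCons embedding_0[OF F0(1) h] embedding_1[OF F0(1) h]
          embedding_uminus[OF F0(1) h] split: nat.splits)
  have "coeff P p = 1"
    using \<open>p > 1\<close> by (auto simp: P coeff_pCons split: nat.splits)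
  hence "degree P \<ge> p"
    by (auto intro!: le_degree)
  obtain c A where A: "set_mset A \<subseteq> K n" "P = smult c (\<Prod>a\<in>#A. [:-a, 1:])"
    using split by (auto simp: splits_over_def P_def)
  have "A \<noteq> {#}"
  proof
    assume "A = {#}"
    hence "P = [:c:]"
      using A(2) by simp
    thus False
      using \<open>degree P \<ge> p\<close> \<open>p > 1\<close> by simp
  qed
  then obtain a where a: "a \<in># A" by blast
  hence "poly P a = 0"
    by (auto simp: A(2) poly_prod_mset prod_mset_zero_iff)
  hence "a ^ p - a = h t"
    by (simp add: P poly_monom)
  hence "to_ac a ^ p - to_ac a = s"
    by (simp add: s_def h'_def flip: to_ac_power to_ac_diff)
  moreover have "to_ac a \<in> L"
    using a A(1) L(2) by auto
  ultimately show False
    using L(1) by (auto simp: artin_schreier_rootfree_def)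
qed

lemma to_ac_chebyshev_power: "to_ac (chebyshev_power x n) = chebyshev_power (to_ac x) n"
  by (induction x n rule: chebyshev_power.induct) auto

theorem theorem74:
  fixes p :: nat and F :: "'a::field set" and t :: 'a
  assumes "prime p" and "odd p"
    and "is_subfield F" and "CHAR('a) = p"
    and "transcendental_over F t"
  shows "\<not> solvable_in_radicals TYPE('b::field) (field_adjoin F t) (monom 1 p - monom 1 1 - [:t:])
       \<and> \<not> solvable_in_chebyshev_radicals TYPE('b) (field_adjoin F t) (monom 1 p - monom 1 1 - [:t:])"
proof
  show "\<not> solvable_in_radicals TYPE('b::field) (field_adjoin F t) (monom 1 p - monom 1 1 - [:t:])"
    unfolding solvable_in_radicals_def
  proof (rule not_solvable_by_powers[OF assms(1,4,3,5), where pow' = "(^)"])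
    fix s r :: "'b alg_closure" and K m
    assume "CHAR('b alg_closure) = p" "artin_schreier_rootfree p s K" "m > 0" "r ^ m \<in> K"
    from rootfree_radical_extension[OF assms(1) this]
    show "\<exists>L. artin_schreier_rootfree p s L \<and> K \<subseteq> L \<and> r \<in> L"
      using subset_field_adjoin[of K r] adjoined_in_field_adjoin[of r K] by blast
  qed auto
  show "\<not> solvable_in_chebyshev_radicals TYPE('b::field) (field_adjoin F t) (monom 1 p - monom 1 1 - [:t:])"
    unfolding solvable_in_chebyshev_radicals_def
  proof (rule not_solvable_by_powers[OF assms(1,4,3,5), where pow' = chebyshev_power])
    fix s r :: "'b alg_closure" and K m
    assume "CHAR('b alg_closure) = p" "artin_schreier_rootfree p s K" "m > 0" "chebyshev_power r m \<in> K"
    from rootfree_chebyshev_extension[OF assms(1,2) this]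
    show "\<exists>L. artin_schreier_rootfree p s L \<and> K \<subseteq> L \<and> r \<in> L" .
  qed (rule to_ac_chebyshev_power)
qed

end
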